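(* Let $G_1,G_2$ be finite simple connected graphs, $G_1$ having $n_1$ vertices and $m_1$ edges, and let $\emptyset\neq U\subseteq V(G_2)$. Then the generalized hierarchical product satisfies \[F(G_1\Pi G_2(U))=|U|F(G_1)+n_1F(G_2)+3M_1(G_1)\sum_{v\in U}d_{G_2}(v)+6m_1\sum_{v\in U}d_{G_2}(v)^2.\]
   Context: The generalized hierarchical product $G_1\Pi G_2(U)$ has vertex set $V(G_1)\times V(G_2)$, with $(u,v)$ adjacent to $(u',v')$ iff [$u=u'$ and $vv'\in E(G_2)$] or [$v=v'\in U$ and $uu'\in E(G_1)$]. For a finite simple graph $G$ with vertex degrees $d_G(v)$: $M_1(G)=\sum_{v} d_G(v)^2$ and $F(G)=\sum_{v} d_G(v)^3$. *)

theory Defs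
  imports "Graph_Theory.Graph_Theory"
begin

text \<open>
  A finite simple graph is a \<^locale>\<open>pair_graph\<close>: an undirected edge \<open>{u, v}\<close> is represented by the two
  arcs \<open>(u, v)\<close> and \<open>(v, u)\<close>. Hence the number of edges is half the number of arcs, and the degree
  of a vertex is its out-degree (see \<open>degree_eq_card_incident_edges\<close>).
\<close>

definition edges :: "'a pair_pre_digraph \<Rightarrow> 'a set set" where
  "edges G = {{u, v} | u v. (u, v) \<in> parcs G}"

definition degree :: "'a pair_pre_digraph \<Rightarrow> 'a \<Rightarrow> nat" where
  "degree G v = out_degree (with_proj G) v"

definition first_zagreb :: "'a pair_pre_digraph \<Rightarrow> nat" where
  "first_zagreb G = (\<Sum>v\<in>pverts G. degree G v ^ 2)"

definition forgotten_index :: "'a pair_pre_digraph \<Rightarrow> nat" where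
  "forgotten_index G = (\<Sum>v\<in>pverts G. degree G v ^ 3)"

definition hierarchical_product ::
  "'a pair_pre_digraph \<Rightarrow> 'b pair_pre_digraph \<Rightarrow> 'b set \<Rightarrow> ('a \<times> 'b) pair_pre_digraph" where
  "hierarchical_product G\<^sub>1 G\<^sub>2 U =
     \<lparr> pverts = pverts G\<^sub>1 \<times> pverts G\<^sub>2,
       parcs = {((u, v), (u', v')) | u v u' v'.
         (u, v) \<in> pverts G\<^sub>1 \<times> pverts G\<^sub>2 \<and> (u', v') \<in> pverts G\<^sub>1 \<times> pverts G\<^sub>2 \<and>
         ((u = u' \<and> (v, v') \<in> parcs G\<^sub>2) \<or> (v = v' \<and> v \<in> U \<and> (u, u') \<in> parcs G\<^sub>1))} \<rparr>"

lemma degree_eq_card_incident_edges: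
  assumes "pair_graph G"
  shows "degree G v = card {e \<in> edges G. v \<in> e}"
proof -
  interpret pair_graph G by fact
  have sym: "(b, a) \<in> parcs G" if "(a, b) \<in> parcs G" for a b
    using that arcs_symmetric by auto
  have "bij_betw (\<lambda>(a, b). {a, b}) (out_arcs (with_proj G) v) {e \<in> edges G. v \<in> e}"
    unfolding bij_betw_def
  proof
    show "inj_on (\<lambda>(a, b). {a, b}) (out_arcs (with_proj G) v)"
      by (auto simp: inj_on_def doubleton_eq_iff out_arcs_def)
    show "(\<lambda>(a, b). {a, b}) ` out_arcs (with_proj G) v = {e \<in> edges G. v \<in> e}"
    proof (intro equalityI subsetI)
      fix e assume "e \<in> {e \<in> edges G. v \<in> e}"
      then obtain a b where ab: "(a, b) \<in> parcs G" "e = {a, b}" "v = a \<or> v = b"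
        by (auto simp: edges_def)
      then have "\<exists>w. (v, w) \<in> parcs G \<and> e = {v, w}"
        using sym by blast
      then show "e \<in> (\<lambda>(a, b). {a, b}) ` out_arcs (with_proj G) v"
        by (force simp: out_arcs_def)
    qed (auto simp: edges_def out_arcs_def)
  qed
  then show ?thesis
    by (simp add: degree_def out_degree_def bij_betw_same_card)
qed

lemma pair_graph_hierarchical_product:
  assumes "pair_graph G\<^sub>1" "pair_graph G\<^sub>2"
  shows "pair_graph (hierarchical_product G\<^sub>1 G\<^sub>2 U)"
proof -
  interpret G1: pair_graph G\<^sub>1 by fact
  interpret G2: pair_graph G\<^sub>2 by fact
  let ?P = "hierarchical_product G\<^sub>1 G\<^sub>2 U"
  have sub: "parcs ?P \<subseteq> pverts ?P \<times> pverts ?P"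
    by (auto simp: hierarchical_product_def)
  have fin: "finite (pverts ?P)"
    using G1.pair_finite_verts G2.pair_finite_verts by (simp add: hierarchical_product_def)
  have "finite (parcs ?P)"
    using finite_subset[OF sub] fin by blast
  moreover have "symmetric (with_proj ?P)"
    using G1.arcs_symmetric G2.arcs_symmetric
    by (auto simp: symmetric_conv hierarchical_product_def)
  moreover have "fst e \<noteq> snd e" if "e \<in> parcs ?P" for e
    using that G1.pair_no_loops G2.pair_no_loops by (fastforce simp: hierarchical_product_def)
  ultimately show ?thesis
    using fin sub by unfold_locales auto
qed

end

theory Submission
  imports Defs
begin

lemma degree_eq_card_neighbours: "degree G v = card {w. (v, w) \<in> parcs G}"
proof -
  have "out_arcs (with_proj G) v = Pair v ` {w. (v, w) \<in> parcs G}"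
    by (auto simp: out_arcs_def)
  then show ?thesis
    by (simp add: degree_def out_degree_def card_image inj_on_def)
qed

lemma sum_degree_eq_twice_card_edges:
  assumes "pair_graph G"
  shows "(\<Sum>v\<in>pverts G. degree G v) = 2 * card (edges G)"
proof -
  interpret pair_graph G by fact
  have "edges G = (\<lambda>(u, v). {u, v}) ` parcs G"
    by (auto simp: edges_def)
  then have fin: "finite (edges G)"
    using pair_finite_arcs by simp
  have two: "card {v \<in> pverts G. v \<in> e} = 2" if "e \<in> edges G" for e
  proof -
    from that obtain a b where ab: "(a, b) \<in> parcs G" "e = {a, b}"
      by (auto simp: edges_def)
    then have "a \<noteq> b" "a \<in> pverts G" "b \<in> pverts G"
      using pair_no_loops in_arcsD1 in_arcsD2 by fastforce+
    with ab have "{v \<in> pverts G. v \<in> e} = {a, b}" by auto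
    with \<open>a \<noteq> b\<close> show ?thesis by simp
  qed
  have "(\<Sum>v\<in>pverts G. card {e \<in> edges G. v \<in> e}) = 2 * card (edges G)"
    by (rule sum_multicount) (use fin two pair_finite_verts in auto)
  then show ?thesis
    by (simp add: degree_eq_card_incident_edges[OF assms])
qed

lemma degree_hierarchical_product:
  assumes "pair_graph G\<^sub>1" "pair_graph G\<^sub>2" "u \<in> pverts G\<^sub>1" "v \<in> pverts G\<^sub>2"
  shows "degree (hierarchical_product G\<^sub>1 G\<^sub>2 U) (u, v) =
    degree G\<^sub>2 v + (if v \<in> U then degree G\<^sub>1 u else 0)"
proof -
  interpret G1: pair_graph G\<^sub>1 by fact
  interpret G2: pair_graph G\<^sub>2 by fact
  let ?N\<^sub>1 = "{u'. (u, u') \<in> parcs G\<^sub>1}" and ?N\<^sub>2 = "{v'. (v, v') \<in> parcs G\<^sub>2}"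
  let ?A = "Pair u ` ?N\<^sub>2" and ?B = "if v \<in> U then (\<lambda>u'. (u', v)) ` ?N\<^sub>1 else {}"
  have mem: "?N\<^sub>1 \<subseteq> pverts G\<^sub>1" "?N\<^sub>2 \<subseteq> pverts G\<^sub>2"
    using G1.in_arcsD2 G2.in_arcsD2 by fastforce+
  then have fin: "finite ?N\<^sub>1" "finite ?N\<^sub>2"
    using G1.pair_finite_verts G2.pair_finite_verts by (auto intro: finite_subset)
  have "{w. ((u, v), w) \<in> parcs (hierarchical_product G\<^sub>1 G\<^sub>2 U)} = ?A \<union> ?B"
    using mem assms(3,4) by (auto simp: hierarchical_product_def)
  moreover have "?A \<inter> ?B = {}"
    using G1.pair_no_loops[of "(u, u)"] by auto
  ultimately have "degree (hierarchical_product G\<^sub>1 G\<^sub>2 U) (u, v) = card ?A + card ?B"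
    using fin by (simp add: degree_eq_card_neighbours card_Un_disjoint)
  then show ?thesis
    by (simp add: degree_eq_card_neighbours card_image inj_on_def)
qed

theorem theorem9:
  fixes G\<^sub>1 :: "'a pair_pre_digraph" and G\<^sub>2 :: "'b pair_pre_digraph"
    and U :: "'b set" and n\<^sub>1 m\<^sub>1 :: nat
  assumes "pair_graph G\<^sub>1" and "connected (with_proj G\<^sub>1)"
    and "pair_graph G\<^sub>2" and "connected (with_proj G\<^sub>2)"
    and "n\<^sub>1 = card (pverts G\<^sub>1)" and "m\<^sub>1 = card (edges G\<^sub>1)"
    and "U \<noteq> {}" and "U \<subseteq> pverts G\<^sub>2"
  shows "forgotten_index (hierarchical_product G\<^sub>1 G\<^sub>2 U) =
    card U * forgotten_index G\<^sub>1 + n\<^sub>1 * forgotten_index G\<^sub>2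
    + 3 * first_zagreb G\<^sub>1 * (\<Sum>v\<in>U. degree G\<^sub>2 v)
    + 6 * m\<^sub>1 * (\<Sum>v\<in>U. degree G\<^sub>2 v ^ 2)"
proof -
  interpret G2: pair_graph G\<^sub>2 by fact
  let ?V\<^sub>1 = "pverts G\<^sub>1" and ?V\<^sub>2 = "pverts G\<^sub>2"
  let ?d\<^sub>1 = "degree G\<^sub>1" and ?d\<^sub>2 = "degree G\<^sub>2"
  let ?g = "\<lambda>v. forgotten_index G\<^sub>1 + 3 * first_zagreb G\<^sub>1 * ?d\<^sub>2 v + 6 * m\<^sub>1 * ?d\<^sub>2 v ^ 2"
  have cube: "(a + b) ^ 3 = a ^ 3 + (b ^ 3 + 3 * a * b ^ 2 + 3 * a ^ 2 * b)" for a b :: nat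
    by algebra
  have fibre: "(\<Sum>u\<in>?V\<^sub>1. (?d\<^sub>2 v + (if v \<in> U then ?d\<^sub>1 u else 0)) ^ 3) =
      n\<^sub>1 * ?d\<^sub>2 v ^ 3 + (if v \<in> U then ?g v else 0)" for v
  proof (cases "v \<in> U")
    case True
    have "(\<Sum>u\<in>?V\<^sub>1. (?d\<^sub>2 v + ?d\<^sub>1 u) ^ 3) = n\<^sub>1 * ?d\<^sub>2 v ^ 3 + (forgotten_index G\<^sub>1
        + 3 * ?d\<^sub>2 v * first_zagreb G\<^sub>1 + 3 * ?d\<^sub>2 v ^ 2 * (\<Sum>u\<in>?V\<^sub>1. ?d\<^sub>1 u))"
      unfolding cube forgotten_index_def first_zagreb_def
      by (simp add: sum.distrib sum_distrib_left assms(5))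
    then show ?thesis
      using True by (simp add: sum_degree_eq_twice_card_edges[OF assms(1)] assms(6))
  qed (simp add: assms(5))
  have "forgotten_index (hierarchical_product G\<^sub>1 G\<^sub>2 U) =
      (\<Sum>(u, v)\<in>?V\<^sub>1 \<times> ?V\<^sub>2. (?d\<^sub>2 v + (if v \<in> U then ?d\<^sub>1 u else 0)) ^ 3)"
    unfolding forgotten_index_def
    by (rule sum.cong)
      (auto simp: hierarchical_product_def
        simp flip: degree_hierarchical_product[OF assms(1,3), of _ _ U])
  also have "\<dots> = (\<Sum>v\<in>?V\<^sub>2. \<Sum>u\<in>?V\<^sub>1. (?d\<^sub>2 v + (if v \<in> U then ?d\<^sub>1 u else 0)) ^ 3)"
    unfolding sum.cartesian_product[symmetric] by (rule sum.swap)
  also have "\<dots> = n\<^sub>1 * forgotten_index G\<^sub>2 + (\<Sum>v\<in>?V\<^sub>2. if v \<in> U then ?g v else 0)"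
    by (simp add: fibre sum.distrib sum_distrib_left forgotten_index_def)
  also have "(\<Sum>v\<in>?V\<^sub>2. if v \<in> U then ?g v else 0) = (\<Sum>v\<in>U. ?g v)"
    using assms(8) G2.pair_finite_verts by (simp add: sum.If_cases Int_absorb1)
  also have "\<dots> = card U * forgotten_index G\<^sub>1 + 3 * first_zagreb G\<^sub>1 * (\<Sum>v\<in>U. ?d\<^sub>2 v)
      + 6 * m\<^sub>1 * (\<Sum>v\<in>U. ?d\<^sub>2 v ^ 2)"
    by (simp add: sum.distrib sum_distrib_left)
  finally show ?thesis by simp
qed

end
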